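(* Let $r\in(0,1]$, $\alpha\in(0,1]$ and $\mu>0$. Then the generalized negative binomial distribution with parameters $r,\alpha,\mu$ is a $Y_{r,\alpha,\mu}$-mixed geometric distribution: $$\mathsf P(N_{r,\alpha,\mu}=k)=\int_0^1 y(1-y)^k\,d\mathsf P(Y_{r,\alpha,\mu}<y),\qquad k=0,1,2,\dots,$$ where $$Y_{r,\alpha,\mu}\stackrel{d}{=}\frac{S_{\alpha,1}Z_{r,\mu}^{1/\alpha}}{1+S_{\alpha,1}Z_{r,\mu}^{1/\alpha}}\stackrel{d}{=}\frac{\mu^{1/\alpha}S_{\alpha,1}(G_{r,1}+G_{1-r,1})^{1/\alpha}}{G_{r,1}^{1/\alpha}+\mu^{1/\alpha}S_{\alpha,1}(G_{r,1}+G_{1-r,1})^{1/\alpha}},$$ with $S_{\alpha,1}$ and $Z_{r,\mu}$ independent, respectively $S_{\alpha,1}$, $G_{r,1}$, $G_{1-r,1}$ independent.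
   Context: For $r>0$, $\lambda>0$ and real $\alpha\ne0$, the generalized gamma distribution has density $g^*(x;r,\alpha,\lambda)=\frac{|\alpha|\lambda^r}{\Gamma(r)}x^{\alpha r-1}e^{-\lambda x^{\alpha}}$, $x\ge0$. A random variable $N_{r,\alpha,\mu}$ has the generalized negative binomial (GNB) distribution if $\mathsf P(N_{r,\alpha,\mu}=k)=\frac1{k!}\int_0^\infty e^{-z}z^k g^*(z;r,\alpha,\mu)\,dz$, $k=0,1,2,\dots$ (a Poisson distribution mixed over a GG law). $G_{s,1}$ denotes a gamma random variable with density $\frac{1}{\Gamma(s)}x^{s-1}e^{-x}$, $x\ge0$, for $s>0$, and $G_{0,1}:=0$. For $0<\alpha\le1$, $S_{\alpha,1}$ is a random variable with characteristic function $\exp\{-|t|^{\alpha}\exp(-\tfrac12 i\pi\alpha\,\mathrm{sign}\,t)\}$ (degenerate at $1$ when $\alpha=1$). For $r\in(0,1]$, $\mu>0$: $Z_{r,\mu}=\mu(G_{r,1}+G_{1-r,1})/G_{r,1}$ with independent gamma factors (so $Z_{1,\mu}=\mu$). If $Y$ is a random variable with values in $(0,1)$, a random variable $V$ has the $Y$-mixed geometric distribution if $\mathsf P(V=k)=\int_0^1 y(1-y)^k\,d\mathsf P(Y<y)$, $k\ge0$. *)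

theory Defs
  imports "HOL-Probability.Probability"
begin

definition gg_density :: "real \<Rightarrow> real \<Rightarrow> real \<Rightarrow> real \<Rightarrow> real" where
  "gg_density r \<alpha> lam x =
     (if x \<ge> 0 then \<bar>\<alpha>\<bar> * lam powr r / Gamma r * x powr (\<alpha> * r - 1) * exp (- lam * x powr \<alpha>)
      else 0)"

definition gnb_prob :: "real \<Rightarrow> real \<Rightarrow> real \<Rightarrow> nat \<Rightarrow> real" where
  "gnb_prob r \<alpha> \<mu> k =
     1 / fact k * (\<integral>z. indicator {0..} z * exp (- z) * z ^ k * gg_density r \<alpha> \<mu> z \<partial>lborel)"

definition gamma_law :: "real \<Rightarrow> real measure" where
  "gamma_law s = (if s = 0 then return borel 0
     else density lborel (\<lambda>x. ennreal (indicator {0..} x * x powr (s - 1) * exp (- x) / Gamma s)))"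

definition stable_char :: "real \<Rightarrow> real \<Rightarrow> complex" where
  "stable_char \<alpha> t = exp (- complex_of_real (\<bar>t\<bar> powr \<alpha>) *
       exp (- (1/2) * \<i> * complex_of_real (pi * \<alpha> * sgn t)))"

text \<open>Z_{r,mu} = mu (G_r + G_{1-r}) / G_r, and
  Y = S Z^{1/alpha} / (1 + S Z^{1/alpha}) as a function of (S, G_r, G_{1-r}).\<close>
definition Y_fun :: "real \<Rightarrow> real \<Rightarrow> real \<times> real \<times> real \<Rightarrow> real" where
  "Y_fun \<alpha> \<mu> = (\<lambda>(s, g1, g2).
     let z = \<mu> * (g1 + g2) / g1; w = s * z powr (1 / \<alpha>) in w / (1 + w))"

definition Y_law :: "real measure \<Rightarrow> real \<Rightarrow> real \<Rightarrow> real \<Rightarrow> real measure" where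
  "Y_law PS r \<alpha> \<mu> =
     distr (PS \<Otimes>\<^sub>M (gamma_law r \<Otimes>\<^sub>M gamma_law (1 - r))) borel (Y_fun \<alpha> \<mu>)"

end

theory Submission
  imports Defs
begin

text \<open>
  Given \<open>W = S * Z powr (1/\<alpha>)\<close> and \<open>Y = W / (1 + W)\<close>, the geometric weight is a Gamma integral:
  \<open>Y * (1 - Y) ^ k = W / (1 + W) ^ (k+1)\<close> is \<open>1/k!\<close> times the integral of
  \<open>z ^ k * exp (-z) * W * exp (- W * z)\<close> over positive \<open>z\<close>,
  so by Tonelli it suffices that \<open>E[W * exp (- W * z)]\<close> is the generalized gamma density at \<open>z\<close>.
  Conditionally on \<open>Z\<close> this is the derivative of the Laplace transform \<open>exp (- l powr \<alpha>)\<close> of \<open>S\<close>;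
  integrating out \<open>Z\<close> is the substitution \<open>y = x t\<close> in the double Gamma integral.

  That a law with characteristic function \<open>stable_char \<alpha>\<close> lives on the positive half-line and has
  this Laplace transform is obtained from a limit theorem: the Sibuya law on the naturals has
  generating function \<open>1 - (1 - z) powr \<alpha>\<close>, so its \<open>n\<close>-fold sums scaled by \<open>n powr (-1/\<alpha>)\<close> satisfy
  \<open>E[exp (- w * S\<^sub>n)] \<longlonglongrightarrow> exp (- (w powr \<alpha>))\<close> for \<open>Re w \<ge> 0\<close>. Purely imaginary \<open>w\<close> gives weak
  convergence to the stable law by Levy's theorem, which transfers positivity, and real \<open>w\<close> then
  gives the Laplace transform.
\<close>

subsection \<open>The Sibuya distribution\<close>

text \<open>The coefficient of \<open>z ^ k\<close> in \<open>1 - (1 - z) powr \<alpha>\<close>; at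
  \<open>k = 0\<close> the two constant terms cancel.\<close>

definition sibuya_coeff :: "real \<Rightarrow> nat \<Rightarrow> real" where
  "sibuya_coeff \<alpha> k = (if k = 0 then 0 else - ((-1) ^ k * (\<alpha> gchoose k)))"

text \<open>The factor -\<alpha> split off \<open>pochhammer (-\<alpha>) k\<close> absorbs the outer
  minus sign, and the remaining factors 1 - \<alpha>, 2 - \<alpha>, ... are nonnegative because
  \<alpha> \<le> 1.\<close>

lemma sibuya_coeff_nonneg:
  assumes "0 < \<alpha>" "\<alpha> \<le> 1"
  shows "0 \<le> sibuya_coeff \<alpha> k"
proof (cases k)
  case (Suc m)
  have "(-1) ^ k * (\<alpha> gchoose k) = pochhammer (-\<alpha>) k / fact k"
    by (simp add: gbinomial_pochhammer power_mult_distrib[symmetric])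
  also have "pochhammer (-\<alpha>) k = - \<alpha> * pochhammer (1 - \<alpha>) m"
    by (simp add: Suc pochhammer_rec)
  finally have "sibuya_coeff \<alpha> k = \<alpha> * pochhammer (1 - \<alpha>) m / fact k"
    by (simp add: sibuya_coeff_def Suc)
  moreover have "0 \<le> pochhammer (1 - \<alpha>) m"
    using assms by (auto simp: pochhammer_prod intro!: prod_nonneg)
  ultimately show ?thesis using assms by simp
qed (simp add: sibuya_coeff_def)

text \<open>Alternating sums of binomial coefficients collapse, so the partial sum up to
  \<open>n\<close> differs from 1 only by \<open>(-1) ^ n * ((\<alpha> - 1) gchoose n)\<close>. This
  error is at most of order \<open>n powr -\<alpha>\<close>.\<close>

lemma sibuya_coeff_sums:
  assumes "0 < \<alpha>"
  shows "sibuya_coeff \<alpha> sums 1"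
proof -
  \<comment> \<open>Here \<open>exp (\<alpha> * ln n)\<close> stands for
    \<open>n powr \<alpha>\<close>; multiplying the convergent ratio by its reciprocal leaves the
    error term and forces the limit 0.\<close>
  have "(\<lambda>n. ((\<alpha> - 1) gchoose n) / ((-1)^n / exp (\<alpha> * ln (real n)))) \<longlonglongrightarrow> inverse (Gamma (1 - \<alpha>))"
    using gbinomial_asymptotic[of "\<alpha> - 1"] by simp
  moreover have "(\<lambda>n. exp (- (\<alpha> * ln (real n)))) \<longlonglongrightarrow> 0"
    using assms by real_asymp
  ultimately have "(\<lambda>n. ((\<alpha> - 1) gchoose n) / ((-1)^n / exp (\<alpha> * ln (real n))) * exp (- (\<alpha> * ln (real n))))
      \<longlonglongrightarrow> inverse (Gamma (1 - \<alpha>)) * 0"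
    by (rule tendsto_mult)
  also have "(\<lambda>n. ((\<alpha> - 1) gchoose n) / ((-1)^n / exp (\<alpha> * ln (real n))) * exp (- (\<alpha> * ln (real n)))) =
      (\<lambda>n. (-1) ^ n * ((\<alpha> - 1) gchoose n))"
  proof
    fix n :: nat
    show "((\<alpha> - 1) gchoose n) / ((-1)^n / exp (\<alpha> * ln (real n))) * exp (- (\<alpha> * ln (real n))) =
      (-1) ^ n * ((\<alpha> - 1) gchoose n)"
      by (cases "even n") (simp_all add: exp_minus)
  qed
  finally have lim: "(\<lambda>n. (-1) ^ n * ((\<alpha> - 1) gchoose n)) \<longlonglongrightarrow> 0" by simp
  have "(\<Sum>k\<le>n. sibuya_coeff \<alpha> k) = 1 - (-1) ^ n * ((\<alpha> - 1) gchoose n)" for n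
  proof -
    have "(\<Sum>k\<le>n. sibuya_coeff \<alpha> k) = (\<Sum>k\<le>n. (if k = 0 then 1 else 0) - (\<alpha> gchoose k) * (-1) ^ k)"
      by (intro sum.cong) (auto simp: sibuya_coeff_def)
    also have "\<dots> = 1 - (\<Sum>k\<le>n. (\<alpha> gchoose k) * (-1) ^ k)"
      by (simp add: sum_subtractf)
    finally show ?thesis by (simp add: gbinomial_sum_lower_neg)
  qed
  moreover have "(\<lambda>n. 1 - (-1) ^ n * ((\<alpha> - 1) gchoose n)) \<longlonglongrightarrow> 1 - 0"
    by (intro tendsto_diff lim tendsto_const)
  ultimately show ?thesis by (simp add: sums_def_le)
qed

definition sibuya_pmf :: "real \<Rightarrow> nat pmf" where
  "sibuya_pmf \<alpha> = embed_pmf (sibuya_coeff \<alpha>)"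

lemma pmf_sibuya:
  assumes "0 < \<alpha>" "\<alpha> \<le> 1"
  shows "pmf (sibuya_pmf \<alpha>) k = sibuya_coeff \<alpha> k"
  unfolding sibuya_pmf_def
proof (rule pmf_embed_pmf)
  show "0 \<le> sibuya_coeff \<alpha> x" for x
    using assms by (rule sibuya_coeff_nonneg)
  then show "(\<integral>\<^sup>+x. ennreal (sibuya_coeff \<alpha> x) \<partial>count_space UNIV) = 1"
    using sibuya_coeff_sums[OF assms(1)]
    by (simp add: nn_integral_count_space_nat suminf_ennreal_eq sums_unique[symmetric])
qed

text \<open>Inside the disc the generalized binomial series of \<open>(1 - z) powr \<alpha>\<close>
  converges, and its coefficients are the probabilities up to sign and constant term.\<close>

lemma sibuya_pgf_interior:
  fixes z :: complex
  assumes "0 < \<alpha>" "\<alpha> \<le> 1" "norm z < 1"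
  shows "(\<integral>k. z ^ k \<partial>sibuya_pmf \<alpha>) = 1 - (1 - z) powr \<alpha>"
proof -
  have int: "integrable (measure_pmf (sibuya_pmf \<alpha>)) (\<lambda>k. z ^ k)"
    using assms by (intro measure_pmf.integrable_const_bound[where B=1])
      (auto simp: norm_power power_le_one)
  have eq: "measure_pmf (sibuya_pmf \<alpha>) = density (count_space UNIV) (\<lambda>k. ennreal (sibuya_coeff \<alpha> k))"
    by (subst measure_pmf_eq_density) (simp add: pmf_sibuya assms)
  have "(\<integral>k. z ^ k \<partial>sibuya_pmf \<alpha>) = (\<integral>k. sibuya_coeff \<alpha> k *\<^sub>R z ^ k \<partial>count_space UNIV)"
    unfolding eq by (subst integral_density) (auto simp: sibuya_coeff_nonneg assms)
  also have "\<dots> = (\<Sum>k. sibuya_coeff \<alpha> k *\<^sub>R z ^ k)"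
    using int unfolding eq
    by (subst (asm) integrable_density)
      (auto simp: sibuya_coeff_nonneg assms intro!: integral_count_space_nat)
  also have "(\<lambda>k. sibuya_coeff \<alpha> k *\<^sub>R z ^ k) sums (1 - (1 - z) powr \<alpha>)"
  proof -
    have "(\<lambda>k. (complex_of_real \<alpha> gchoose k) * (-z) ^ k) sums (1 - z) powr \<alpha>"
      using gen_binomial_complex[of "-z" \<alpha>] assms by simp
    moreover have "(\<lambda>k. if k = 0 then 1 else 0 :: complex) sums 1"
      using sums_single[of 0 "\<lambda>_. 1 :: complex"] by simp
    ultimately have "(\<lambda>k. (if k = 0 then 1 else 0) - (complex_of_real \<alpha> gchoose k) * (-z) ^ k)
        sums (1 - (1 - z) powr \<alpha>)"
      by (intro sums_diff)
    also have "(\<lambda>k. (if k = 0 then 1 else 0) - (complex_of_real \<alpha> gchoose k) * (-z) ^ k) =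
        (\<lambda>k. sibuya_coeff \<alpha> k *\<^sub>R z ^ k)"
      by (auto simp: sibuya_coeff_def scaleR_conv_of_real gbinomial_pochhammer pochhammer_of_real[symmetric] power_minus[of z] fun_eq_iff)
    finally show ?thesis .
  qed
  then have "(\<Sum>k. sibuya_coeff \<alpha> k *\<^sub>R z ^ k) = 1 - (1 - z) powr \<alpha>"
    by (rule sums_unique[symmetric])
  finally show ?thesis .
qed

text \<open>Characteristic functions evaluate the generating function on the unit circle. The
  interior formula extends there radially: dominated convergence on the left, continuity of the
  principal power on the right. At \<open>z = 1\<close> both sides are 1.\<close>

lemma sibuya_pgf:
  fixes z :: complex
  assumes "0 < \<alpha>" "\<alpha> \<le> 1" "norm z \<le> 1"
  shows "(\<integral>k. z ^ k \<partial>sibuya_pmf \<alpha>) = 1 - (1 - z) powr \<alpha>"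
proof (cases "z = 1")
  case False
  define s where "s n = 1 - inverse (real (Suc n))" for n
  have s: "0 \<le> s n" "s n < 1" for n by (auto simp: s_def field_simps)
  have s_lim: "s \<longlonglongrightarrow> 1"
    unfolding s_def using tendsto_diff[OF tendsto_const LIMSEQ_inverse_real_of_nat, of 1] by simp
  have "(\<lambda>n. \<integral>k. (of_real (s n) * z) ^ k \<partial>sibuya_pmf \<alpha>) \<longlonglongrightarrow> (\<integral>k. z ^ k \<partial>sibuya_pmf \<alpha>)"
  proof (rule integral_dominated_convergence[where w="\<lambda>_. 1"])
    show "AE k in measure_pmf (sibuya_pmf \<alpha>). (\<lambda>n. (of_real (s n) * z) ^ k) \<longlonglongrightarrow> z ^ k"
      using s_lim by (auto intro!: tendsto_eq_intros)
    show "AE k in measure_pmf (sibuya_pmf \<alpha>). norm ((of_real (s n) * z) ^ k) \<le> 1" for n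
      using s[of n] assms by (auto simp: norm_mult norm_power intro!: power_le_one mult_le_one)
  qed auto
  moreover have "(\<integral>k. (of_real (s n) * z) ^ k \<partial>sibuya_pmf \<alpha>) = 1 - (1 - of_real (s n) * z) powr \<alpha>" for n
  proof (rule sibuya_pgf_interior)
    have "norm (of_real (s n) * z) \<le> s n * 1"
      using s[of n] assms by (simp add: norm_mult mult_left_le)
    then show "norm (of_real (s n) * z) < 1"
      using s[of n] by simp
  qed (use assms in auto)
  moreover have "(\<lambda>n. 1 - (1 - of_real (s n) * z) powr \<alpha>) \<longlonglongrightarrow> 1 - (1 - z) powr \<alpha>"
  proof -
    \<comment> \<open>In the closed disc only \<open>z = 1\<close> puts \<open>1 - z\<close> on the
      branch cut.\<close>
    have "1 - z \<notin> \<real>\<^sub>\<le>\<^sub>0"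
    proof
      assume "1 - z \<in> \<real>\<^sub>\<le>\<^sub>0"
      then have "Re z \<ge> 1" "Im z = 0" by (auto simp: complex_nonpos_Reals_iff)
      with complex_Re_le_cmod[of z] assms False show False
        by (auto simp: complex_eq_iff)
    qed
    then show ?thesis
      using s_lim by (intro tendsto_diff tendsto_const tendsto_powr_complex) (auto intro!: tendsto_eq_intros)
  qed
  ultimately show ?thesis
    by (simp add: LIMSEQ_unique)
qed simp

text \<open>Caratheodory's form of the derivative writes \<open>Ln (1 - x) = g x * x\<close> with
  \<open>g\<close> continuous at 0 and \<open>g 0 = -1\<close>. Hence
  \<open>n * Ln (1 - a n / n)\<close> equals \<open>a n * g (a n / n)\<close> exactly, and no error
  estimate arises.\<close>

lemma LIMSEQ_power_exp_complex:
  fixes a :: "nat \<Rightarrow> complex"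
  assumes "a \<longlonglongrightarrow> l"
  shows "(\<lambda>n. (1 - a n / of_nat n) ^ n) \<longlonglongrightarrow> exp (- l)"
proof -
  have "((\<lambda>x. Ln (1 - x)) has_field_derivative - 1) (at 0)"
    by (auto intro!: derivative_eq_intros)
  then obtain g where g: "\<And>x. Ln (1 - x) - Ln (1 - 0) = g x * (x - 0)" "isCont g 0" "g 0 = -1"
    unfolding CARAT_DERIV by blast
  define x where "x n = a n / of_nat n" for n
  have "x \<longlonglongrightarrow> 0"
    unfolding x_def using tendsto_mult[OF assms lim_inverse_n[where 'a=complex]]
    by (simp add: field_simps)
  then have gx: "(\<lambda>n. g (x n)) \<longlonglongrightarrow> -1"
    using g(2,3) isCont_tendsto_compose by metis
  have "(\<lambda>n. exp (a n * g (x n))) \<longlonglongrightarrow> exp (l * (-1))"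
    by (intro tendsto_intros assms gx)
  moreover have "eventually (\<lambda>n. exp (a n * g (x n)) = (1 - x n) ^ n) sequentially"
  proof -
    have "eventually (\<lambda>n. dist (x n) 0 < 1) sequentially"
      using \<open>x \<longlonglongrightarrow> 0\<close> by (rule tendstoD) simp
    then show ?thesis
      using eventually_gt_at_top[of 0]
    proof eventually_elim
      case (elim n)
      then have "1 - x n \<noteq> 0" by auto
      then have "(1 - x n) ^ n = exp (of_nat n * Ln (1 - x n))"
        by (simp add: exp_of_nat_mult)
      also have "of_nat n * Ln (1 - x n) = a n * g (x n)"
        using elim g(1)[of "x n"] by (simp add: x_def)
      finally show ?case by simp
    qed
  qed
  ultimately show ?thesis
    unfolding x_def by (simp add: tendsto_cong)
qed

subsection \<open>One-sided stable laws as limits of Sibuya sums\<close>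

text \<open>The product measure supplies independent summands. With this scale \<open>c\<close>,
  \<open>(1 - exp (- w * c)) powr \<alpha>\<close> is \<open>w powr \<alpha> / n\<close> to leading
  order, which is what an \<open>n\<close>-fold product needs.\<close>

definition sibuya_sum_law :: "real \<Rightarrow> nat \<Rightarrow> real measure" where
  "sibuya_sum_law \<alpha> n = distr (Pi\<^sub>M {..<n} (\<lambda>_. measure_pmf (sibuya_pmf \<alpha>))) borel
     (\<lambda>x. real n powr (- 1 / \<alpha>) * (\<Sum>i<n. real (x i)))"

lemma measurable_sibuya_sum [measurable]:
  "(\<lambda>x. c * (\<Sum>i<n. real (x i))) \<in> borel_measurable (Pi\<^sub>M {..<n} (\<lambda>_. measure_pmf (sibuya_pmf \<alpha>)))"
proof -
  have "(\<lambda>x. real (x i)) \<in> borel_measurable (Pi\<^sub>M {..<n} (\<lambda>_. measure_pmf (sibuya_pmf \<alpha>)))"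
    if "i \<in> {..<n}" for i
    by (rule measurable_compose[OF measurable_component_singleton[OF that]]) simp
  then show ?thesis
    by (intro borel_measurable_times borel_measurable_sum) auto
qed

lemma real_distribution_sibuya_sum_law: "real_distribution (sibuya_sum_law \<alpha> n)"
proof -
  interpret product_prob_space "\<lambda>_. measure_pmf (sibuya_pmf \<alpha>)" "{..<n}"
    by standard
  show ?thesis
    unfolding sibuya_sum_law_def by (rule P.real_distribution_distr) measurable
qed

lemma AE_sibuya_sum_law_nonneg: "AE x in sibuya_sum_law \<alpha> n. 0 \<le> x"
  unfolding sibuya_sum_law_def
  by (subst AE_distr_iff) (auto intro!: AE_I2 mult_nonneg_nonneg sum_nonneg)

text \<open>By independence the transform is the \<open>n\<close>-th power of the generating
  function at \<open>z = exp (- w * c)\<close>, which lies in the closed unit disc since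
  \<open>Re w\<close> is nonnegative.\<close>

lemma integral_exp_sibuya_sum_law:
  fixes w :: complex
  assumes "0 < \<alpha>" "\<alpha> \<le> 1" "0 \<le> Re w"
  shows "(\<integral>x. exp (- w * of_real x) \<partial>sibuya_sum_law \<alpha> n) =
    (1 - (1 - exp (- w * of_real (real n powr (- 1 / \<alpha>)))) powr \<alpha>) ^ n"
proof -
  interpret product_prob_space "\<lambda>_. measure_pmf (sibuya_pmf \<alpha>)" "{..<n}"
    by standard
  define c where "c = real n powr (- 1 / \<alpha>)"
  define z where "z = exp (- w * of_real c)"
  have c: "0 \<le> c" by (simp add: c_def)
  have z: "norm z \<le> 1"
    using assms c by (simp add: z_def)
  have "(\<integral>x. exp (- w * of_real x) \<partial>sibuya_sum_law \<alpha> n) =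
      (\<integral>x. exp (- w * of_real (c * (\<Sum>i<n. real (x i)))) \<partial>Pi\<^sub>M {..<n} (\<lambda>_. measure_pmf (sibuya_pmf \<alpha>)))"
    unfolding sibuya_sum_law_def c_def by (subst integral_distr) auto
  also have "\<dots> = (\<integral>x. (\<Prod>i<n. z ^ x i) \<partial>Pi\<^sub>M {..<n} (\<lambda>_. measure_pmf (sibuya_pmf \<alpha>)))"
    by (intro Bochner_Integration.integral_cong refl)
      (simp add: z_def sum_distrib_left exp_sum[symmetric] exp_of_nat_mult[symmetric] mult_ac sum_negf)
  also have "\<dots> = (\<Prod>i<n. \<integral>k. z ^ k \<partial>sibuya_pmf \<alpha>)"
    using z by (intro product_integral_prod measure_pmf.integrable_const_bound[where B=1])
      (auto simp: norm_power power_le_one)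
  also have "\<dots> = (1 - (1 - z) powr \<alpha>) ^ n"
    using sibuya_pgf[OF assms(1,2) z] by simp
  finally show ?thesis by (simp add: z_def c_def)
qed

text \<open>Writing \<open>1 - exp (- w * c) = c * g c\<close> with \<open>g c\<close> tending to
  \<open>w\<close>, the factor \<open>c powr \<alpha>\<close> is exactly \<open>1 / n\<close>, so
  the transform has the form \<open>(1 - a n / n) ^ n\<close> with \<open>a n\<close> tending to
  \<open>w powr \<alpha>\<close>. The conditions on \<open>w\<close> keep it off the branch
  cut.\<close>

lemma LIMSEQ_integral_exp_sibuya_sum_law:
  fixes w :: complex
  assumes "0 < \<alpha>" "\<alpha> \<le> 1" "0 \<le> Re w" "w \<noteq> 0"
  shows "(\<lambda>n. \<integral>x. exp (- w * of_real x) \<partial>sibuya_sum_law \<alpha> n) \<longlonglongrightarrow> exp (- (w powr \<alpha>))"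
proof -
  have "((\<lambda>x. 1 - exp (- w * x)) has_field_derivative w) (at 0)"
    by (auto intro!: derivative_eq_intros)
  then obtain g where g: "\<And>x. (1 - exp (- w * x)) - (1 - exp (- w * 0)) = g x * (x - 0)" "isCont g 0" "g 0 = w"
    unfolding CARAT_DERIV by blast
  define c where "c n = real n powr (- 1 / \<alpha>)" for n
  have "c \<longlonglongrightarrow> 0"
    unfolding c_def using assms(1) by real_asymp
  then have "(\<lambda>n. complex_of_real (c n)) \<longlonglongrightarrow> 0"
    using tendsto_of_real by fastforce
  then have "(\<lambda>n. g (of_real (c n))) \<longlonglongrightarrow> w"
    using g(2,3) isCont_tendsto_compose by metis
  moreover have "w \<notin> \<real>\<^sub>\<le>\<^sub>0"
    using assms by (auto simp: complex_nonpos_Reals_iff complex_eq_iff)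
  ultimately have "(\<lambda>n. g (of_real (c n)) powr \<alpha>) \<longlonglongrightarrow> w powr \<alpha>"
    by (intro tendsto_powr_complex) auto
  then have lim: "(\<lambda>n. (1 - g (of_real (c n)) powr \<alpha> / of_nat n) ^ n) \<longlonglongrightarrow> exp (- (w powr \<alpha>))"
    by (rule LIMSEQ_power_exp_complex)
  have "(1 - g (of_real (c n)) powr \<alpha> / of_nat n) ^ n = (\<integral>x. exp (- w * of_real x) \<partial>sibuya_sum_law \<alpha> n)" for n
  proof (cases "n = 0")
    case False
    have "(1 - exp (- w * of_real (c n))) powr \<alpha> = (of_real (c n) * g (of_real (c n))) powr \<alpha>"
      using g(1)[of "of_real (c n)"] by (simp add: mult.commute)
    \<comment> \<open>A complex power splits over this product because \<open>c n\<close> is a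
      nonnegative real.\<close>
    also have "\<dots> = complex_of_real (c n) powr \<alpha> * g (of_real (c n)) powr \<alpha>"
      by (intro powr_times_real_left) (auto simp: c_def)
    also have "complex_of_real (c n) powr \<alpha> = of_real (c n powr \<alpha>)"
      by (intro powr_of_real) (simp add: c_def)
    also have "c n powr \<alpha> = 1 / real n"
      using False assms(1) by (simp only: c_def powr_powr) (simp add: powr_minus_divide)
    finally show ?thesis
      using integral_exp_sibuya_sum_law[OF assms(1-3), of n] by (simp add: c_def)
  qed (use integral_exp_sibuya_sum_law[OF assms(1-3), of n] in simp)
  with lim show ?thesis by simp
qed

section \<open>Identification of the limit with the stable law\<close>

text \<open>The principal argument of \<open>- \<i> * t\<close> is \<open>- pi / 2 * sgn t\<close>,
  which yields the phase factor of \<open>stable_char\<close>. The Sibuya limit at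
  \<open>w = - \<i> * t\<close> is thus the stable characteristic function.\<close>

lemma stable_char_eq_powr:
  assumes "t \<noteq> 0"
  shows "stable_char \<alpha> t = exp (- ((- \<i> * complex_of_real t) powr \<alpha>))"
proof -
  have "Ln (- \<i> * complex_of_real t) = ln \<bar>t\<bar> - \<i> * pi / 2 * sgn t"
  proof (cases "t > 0")
    case True
    then show ?thesis
      using Ln_times_of_real[of t "-\<i>"] by (simp add: mult.commute Ln_of_real)
  next
    case False
    then have "- \<i> * complex_of_real t = complex_of_real (-t) * \<i>" by simp
    moreover have "Ln (complex_of_real (-t) * \<i>) = ln (-t) + Ln \<i>"
      using False assms Ln_times_of_real[of "-t" \<i>] Ln_of_real[of "-t"] by simp
    ultimately show ?thesis using False assms by (simp add: mult.commute)
  qed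
  then have "(- \<i> * complex_of_real t) powr \<alpha> = exp (\<alpha> * (ln \<bar>t\<bar> - \<i> * pi / 2 * sgn t))"
    using assms by (simp add: powr_def)
  also have "\<dots> = exp (complex_of_real (\<alpha> * ln \<bar>t\<bar>)) * exp (- (1/2) * \<i> * complex_of_real (pi * \<alpha> * sgn t))"
    by (simp add: algebra_simps exp_add[symmetric])
  also have "exp (complex_of_real (\<alpha> * ln \<bar>t\<bar>)) = complex_of_real (\<bar>t\<bar> powr \<alpha>)"
    using assms by (simp add: powr_def exp_of_real del: of_real_mult)
  finally show ?thesis by (simp add: stable_char_def)
qed

lemma sibuya_sum_law_weak_conv_stable:
  assumes "0 < \<alpha>" "\<alpha> \<le> 1" "real_distribution P" "\<And>t. char P t = stable_char \<alpha> t"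
  shows "weak_conv_m (sibuya_sum_law \<alpha>) P"
proof (rule levy_continuity)
  fix t
  show "(\<lambda>n. char (sibuya_sum_law \<alpha> n) t) \<longlonglongrightarrow> char P t"
  proof (cases "t = 0")
    \<comment> \<open>The transform limit requires a nonzero argument; at 0 every characteristic
      function is 1.\<close>
    case True
    then show ?thesis
      using real_distribution.char_zero[OF real_distribution_sibuya_sum_law]
        real_distribution.char_zero[OF assms(3)] by simp
  next
    case False
    have "char (sibuya_sum_law \<alpha> n) t = (\<integral>x. exp (- (- \<i> * of_real t) * of_real x) \<partial>sibuya_sum_law \<alpha> n)" for n
      by (simp add: char_def mult_ac)
    with LIMSEQ_integral_exp_sibuya_sum_law[OF assms(1,2), of "- \<i> * of_real t"] False show ?thesis
      by (simp add: assms(4) stable_char_eq_powr)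
  qed
qed (use assms real_distribution_sibuya_sum_law in auto)

text \<open>Weak convergence is tested against bounded continuous functions that detect negative
  mass or agree with \<open>exp (- l * s)\<close> on the half-line. A possible atom at 0 is then
  excluded through the decay of the Laplace transform.\<close>

lemma
  assumes "0 < \<alpha>" "\<alpha> \<le> 1" "real_distribution P" "\<And>t. char P t = stable_char \<alpha> t"
  shows AE_stable_pos: "AE s in P. 0 < s"
    and laplace_stable: "0 < l \<Longrightarrow> (\<integral>s. exp (- l * s) \<partial>P) = exp (- (l powr \<alpha>))"
proof -
  interpret P: real_distribution P by fact
  interpret S: real_distribution "sibuya_sum_law \<alpha> n" for n
    by (rule real_distribution_sibuya_sum_law)
  note conv = weak_conv_imp_integral_bdd_continuous_conv[OF real_distribution_sibuya_sum_law assms(3)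
      sibuya_sum_law_weak_conv_stable[OF assms]]
  \<comment> \<open>This test function vanishes on the nonnegative reals and is positive on the
    negative ones, so a zero integral means no negative mass.\<close>
  have "(\<lambda>n. \<integral>x. min 1 (max 0 (- x)) \<partial>sibuya_sum_law \<alpha> n) \<longlonglongrightarrow> (\<integral>x. min 1 (max 0 (- x)) \<partial>P)"
    by (rule conv[where B=1]) (auto intro!: continuous_intros)
  moreover have "(\<integral>x. min 1 (max 0 (- x)) \<partial>sibuya_sum_law \<alpha> n) = 0" for n
  proof (rule integral_eq_zero_AE)
    show "AE x in sibuya_sum_law \<alpha> n. min 1 (max 0 (- x)) = 0"
      using AE_sibuya_sum_law_nonneg by eventually_elim auto
  qed
  ultimately have "(\<integral>x. min 1 (max 0 (- x)) \<partial>P) = 0"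
    by (simp add: LIMSEQ_const_iff)
  moreover have "integrable P (\<lambda>x. min 1 (max 0 (- x)))"
    by (rule P.integrable_const_bound[where B=1]) auto
  ultimately have "AE x in P. min 1 (max 0 (- x)) = 0"
    by (subst (asm) integral_nonneg_eq_0_iff_AE) auto
  then have nonneg: "AE x in P. 0 \<le> x"
    by eventually_elim (auto simp: min_def max_def split: if_splits)
  have laplace: "(\<integral>s. exp (- l * s) \<partial>P) = exp (- (l powr \<alpha>))" if l: "0 < l" for l
  proof -
    \<comment> \<open>On the negative axis \<open>exp (- l * x)\<close> is unbounded; the cut-off
      \<open>max 0 x\<close> repairs this and changes nothing almost surely.\<close>
    have "(\<lambda>n. \<integral>x. exp (- l * max 0 x) \<partial>sibuya_sum_law \<alpha> n) \<longlonglongrightarrow> (\<integral>x. exp (- l * max 0 x) \<partial>P)"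
      using l by (intro conv[where B=1]) (auto intro!: continuous_intros)
    then have A: "(\<lambda>n. complex_of_real (\<integral>x. exp (- l * max 0 x) \<partial>sibuya_sum_law \<alpha> n)) \<longlonglongrightarrow>
        complex_of_real (\<integral>x. exp (- l * max 0 x) \<partial>P)"
      by (rule tendsto_of_real)
    have B: "complex_of_real (\<integral>x. exp (- l * max 0 x) \<partial>sibuya_sum_law \<alpha> n) =
       (\<integral>x. exp (- of_real l * of_real x) \<partial>sibuya_sum_law \<alpha> n)" for n
    proof -
      have "(\<integral>x. exp (- l * max 0 x) \<partial>sibuya_sum_law \<alpha> n) = (\<integral>x. exp (- l * x) \<partial>sibuya_sum_law \<alpha> n)"
      proof (rule integral_cong_AE)
        show "AE x in sibuya_sum_law \<alpha> n. exp (- l * max 0 x) = exp (- l * x)"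
          using AE_sibuya_sum_law_nonneg by eventually_elim auto
      qed auto
      then show ?thesis
        by (simp add: integral_complex_of_real[symmetric] exp_of_real[symmetric] del: integral_complex_of_real)
    qed
    have C: "(\<lambda>n. \<integral>x. exp (- of_real l * of_real x) \<partial>sibuya_sum_law \<alpha> n) \<longlonglongrightarrow>
        exp (- (complex_of_real l powr \<alpha>))"
      using l assms by (intro LIMSEQ_integral_exp_sibuya_sum_law) auto
    have D: "exp (- (complex_of_real l powr \<alpha>)) = complex_of_real (exp (- (l powr \<alpha>)))"
      using l by (simp add: powr_of_real exp_of_real[symmetric])
    have "complex_of_real (\<integral>x. exp (- l * max 0 x) \<partial>P) = complex_of_real (exp (- (l powr \<alpha>)))"
      by (rule LIMSEQ_unique[OF A[unfolded B] C[unfolded D]])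
    then have "(\<integral>x. exp (- l * max 0 x) \<partial>P) = exp (- (l powr \<alpha>))"
      by (simp only: of_real_eq_iff)
    also have "(\<integral>x. exp (- l * max 0 x) \<partial>P) = (\<integral>x. exp (- l * x) \<partial>P)"
    proof (rule integral_cong_AE)
      show "AE x in P. exp (- l * max 0 x) = exp (- l * x)"
        using nonneg by eventually_elim auto
    qed auto
    finally show ?thesis .
  qed
  then show "0 < l \<Longrightarrow> (\<integral>s. exp (- l * s) \<partial>P) = exp (- (l powr \<alpha>))" .
  \<comment> \<open>The indicator of 0 lies below \<open>exp (- n * x)\<close> on the half-line, so
    the atom is bounded by a Laplace transform tending to 0.\<close>
  have bound: "P.prob {0} \<le> exp (- (real n powr \<alpha>))" if "n > 0" for n :: nat
  proof -
    have "P.prob {0} = (\<integral>x. indicator {0} x \<partial>P)" by simp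
    also have "\<dots> \<le> (\<integral>x. exp (- real n * x) \<partial>P)"
    proof (rule integral_mono_AE)
      show "integrable P (\<lambda>x. exp (- real n * x))"
      proof (rule P.integrable_const_bound[where B=1])
        show "AE x in P. norm (exp (- real n * x)) \<le> 1"
          using nonneg by eventually_elim auto
      qed auto
    qed (auto split: split_indicator intro!: P.integrable_const_bound[where B=1])
    finally show ?thesis using laplace[of "real n"] that by simp
  qed
  have "(\<lambda>n. exp (- (real n powr \<alpha>))) \<longlonglongrightarrow> 0"
    using assms(1) by real_asymp
  then have "P.prob {0} \<le> 0"
    using bound by (intro LIMSEQ_le_const[of "\<lambda>n. exp (- (real n powr \<alpha>))"]) (auto intro!: exI[of _ 1])
  then have "AE x in P. x \<notin> {0}"
    by (subst P.prob_eq_0[symmetric]) (auto simp: measure_le_0_iff)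
  with nonneg show "AE s in P. 0 < s"
    by eventually_elim auto
qed

section \<open>Differentiating the Laplace transform\<close>

text \<open>A derivative as a limit along a sequence, the form in which dominated convergence
  applies.\<close>

lemma DERIV_imp_LIMSEQ_quotient:
  fixes f :: "real \<Rightarrow> real"
  assumes "(f has_real_derivative D) (at x)"
  shows "(\<lambda>n. (f (x + inverse (real (Suc n))) - f x) / inverse (real (Suc n))) \<longlonglongrightarrow> D"
proof -
  have "((\<lambda>h. (f (x + h) - f x) / h) \<longlongrightarrow> D) (at 0)"
    using assms by (simp add: DERIV_def)
  moreover have "filterlim (\<lambda>n. inverse (real (Suc n))) (at 0) sequentially"
    using LIMSEQ_inverse_real_of_nat by (intro filterlim_atI) auto
  ultimately show ?thesis by (rule filterlim_compose)
qed

text \<open>Both sides are minus the derivative in \<open>l\<close> of the Laplace transform;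
  dominated convergence justifies differentiating under the integral.\<close>

lemma nn_integral_stable_mult_exp:
  assumes "0 < \<alpha>" "\<alpha> \<le> 1" "real_distribution P" "\<And>t. char P t = stable_char \<alpha> t"
    and l: "0 < l"
  shows "(\<integral>\<^sup>+s. ennreal (s * exp (- l * s)) \<partial>P) = ennreal (\<alpha> * l powr (\<alpha> - 1) * exp (- (l powr \<alpha>)))"
proof -
  interpret P: real_distribution P by fact
  note pos = AE_stable_pos[OF assms(1-4)]
  define h where "h n = inverse (real (Suc n))" for n
  have h: "0 < h n" for n by (simp add: h_def)
  \<comment> \<open>Negated difference quotient in \<open>l\<close>, with limit
    \<open>s * exp (- l * s)\<close>. It lies between 0 and that limit for positive
    \<open>s\<close>, hence the uniform bound \<open>1 / l\<close>.\<close>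
  define f where "f n s = - ((exp (- (l + h n) * s) - exp (- l * s)) / h n)" for n s
  have bound: "s * exp (- l * s) \<le> 1 / l" if "0 < s" for s
  proof -
    have "l * s \<le> exp (l * s)"
      using exp_ge_add_one_self[of "l * s"] by linarith
    then show ?thesis using l by (simp add: exp_minus field_simps)
  qed
  have f_bound: "norm (f n s) \<le> 1 / l" if "0 < s" for n s
  proof -
    have "f n s = exp (- l * s) * ((1 - exp (- h n * s)) / h n)"
      by (simp add: f_def algebra_simps exp_add[symmetric] diff_divide_distrib)
    moreover have "1 - exp (- h n * s) \<le> h n * s"
      using exp_ge_add_one_self[of "- h n * s"] by linarith
    then have "(1 - exp (- h n * s)) / h n \<le> s"
      using h[of n] by (simp add: field_simps)
    moreover have "0 \<le> (1 - exp (- h n * s)) / h n"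
      using h[of n] that by simp
    ultimately have "0 \<le> f n s" "f n s \<le> exp (- l * s) * s"
      by (simp_all only: mult_nonneg_nonneg mult_left_mono exp_ge_zero)
    with bound[OF that] show ?thesis by (simp add: mult.commute)
  qed
  have f_meas [measurable]: "f n \<in> borel_measurable borel" for n
    unfolding f_def by measurable
  have "(\<lambda>n. \<integral>s. f n s \<partial>P) \<longlonglongrightarrow> (\<integral>s. s * exp (- l * s) \<partial>P)"
  proof (rule integral_dominated_convergence[where w="\<lambda>_. 1 / l"])
    show "AE s in P. norm (f n s) \<le> 1 / l" for n
      using pos by eventually_elim (rule f_bound)
    have "(\<lambda>n. f n s) \<longlonglongrightarrow> s * exp (- l * s)" for s
    proof -
      have "((\<lambda>l. exp (- l * s)) has_real_derivative - s * exp (- l * s)) (at l)"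
        by (auto intro!: derivative_eq_intros)
      from tendsto_minus[OF DERIV_imp_LIMSEQ_quotient[OF this]] show ?thesis
        by (simp add: f_def h_def)
    qed
    then show "AE s in P. (\<lambda>n. f n s) \<longlonglongrightarrow> s * exp (- l * s)" by simp
  qed auto
  moreover have "(\<integral>s. f n s \<partial>P) = - ((exp (- ((l + h n) powr \<alpha>)) - exp (- (l powr \<alpha>))) / h n)" for n
  proof -
    have int: "integrable P (\<lambda>s. exp (- b * s))" if "0 < b" for b
    proof (rule P.integrable_const_bound[where B=1])
      show "AE x in P. norm (exp (- b * x)) \<le> 1"
        using pos by eventually_elim (use that in auto)
    qed auto
    have "0 < l + h n" using l h[of n] by simp
    then show ?thesis
      using int[of l] int[of "l + h n"] l laplace_stable[OF assms(1-4), of l]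
        laplace_stable[OF assms(1-4), of "l + h n"]
      unfolding f_def by simp
  qed
  moreover have "(\<lambda>n. - ((exp (- ((l + h n) powr \<alpha>)) - exp (- (l powr \<alpha>))) / h n)) \<longlonglongrightarrow>
      \<alpha> * l powr (\<alpha> - 1) * exp (- (l powr \<alpha>))"
  proof -
    have "((\<lambda>l. exp (- (l powr \<alpha>))) has_real_derivative - (\<alpha> * l powr (\<alpha> - 1) * exp (- (l powr \<alpha>)))) (at l)"
      using l by (auto intro!: derivative_eq_intros)
    from tendsto_minus[OF DERIV_imp_LIMSEQ_quotient[OF this]] show ?thesis
      by (simp add: h_def)
  qed
  ultimately have "(\<integral>s. s * exp (- l * s) \<partial>P) = \<alpha> * l powr (\<alpha> - 1) * exp (- (l powr \<alpha>))"
    by (simp add: LIMSEQ_unique)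
  moreover have "integrable P (\<lambda>s. s * exp (- l * s))"
  proof (rule P.integrable_const_bound[where B="1 / l"])
    show "AE x in P. norm (x * exp (- l * x)) \<le> 1 / l"
      using pos by eventually_elim (use bound in auto)
  qed auto
  moreover have "AE x in P. 0 \<le> x * exp (- l * x)"
    using pos by eventually_elim auto
  ultimately show ?thesis
    by (simp add: nn_integral_eq_integral)
qed

subsection \<open>Gamma integrals\<close>

text \<open>The substitution replacing \<open>t\<close> by \<open>a * t\<close> in Euler's
  integral.\<close>

lemma nn_integral_gamma_scaled:
  fixes a s :: real
  assumes "0 < s" "0 < a"
  shows "(\<integral>\<^sup>+t. ennreal (indicator {0<..} t * t powr (s - 1) * exp (- a * t)) \<partial>lborel) = ennreal (Gamma s / a powr s)"
proof -
  let ?I = "\<integral>\<^sup>+t. ennreal (indicator {0<..} t * t powr (s - 1) * exp (- a * t)) \<partial>lborel"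
  have "ennreal (Gamma s) = (\<integral>\<^sup>+t. ennreal (indicator {0..} t * t powr (s - 1) / exp t) \<partial>lborel)"
    using assms(1) by (rule Gamma_conv_nn_integral_real)
  also have "\<dots> = ennreal \<bar>a\<bar> * (\<integral>\<^sup>+t. ennreal (indicator {0..} (0 + a * t) * (0 + a * t) powr (s - 1) / exp (0 + a * t)) \<partial>lborel)"
    using assms(2) by (intro nn_integral_real_affine) auto
  also have "(\<lambda>t. ennreal (indicator {0..} (0 + a * t) * (0 + a * t) powr (s - 1) / exp (0 + a * t))) =
      (\<lambda>t. ennreal (a powr (s - 1)) * ennreal (indicator {0<..} t * t powr (s - 1) * exp (- a * t)))"
  proof
    fix t :: real
    \<comment> \<open>At \<open>t = 0\<close> both sides vanish, since \<open>0 powr (s - 1)\<close>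
      is 0.\<close>
    show "ennreal (indicator {0..} (0 + a * t) * (0 + a * t) powr (s - 1) / exp (0 + a * t)) =
      ennreal (a powr (s - 1)) * ennreal (indicator {0<..} t * t powr (s - 1) * exp (- a * t))"
      using assms(2)
      by (cases "t > 0"; cases "t = 0")
        (auto simp: ennreal_mult[symmetric] powr_mult exp_minus field_simps indicator_def zero_le_mult_iff)
  qed
  also have "ennreal \<bar>a\<bar> * (\<integral>\<^sup>+t. ennreal (a powr (s - 1)) * ennreal (indicator {0<..} t * t powr (s - 1) * exp (- a * t)) \<partial>lborel)
      = ennreal \<bar>a\<bar> * (ennreal (a powr (s - 1)) * ?I)"
    by (subst nn_integral_cmult) auto
  also have "\<dots> = ennreal (a powr s) * ?I"
    using assms(2) powr_add[of a 1 "s - 1"] by (simp add: mult.assoc[symmetric] ennreal_mult[symmetric])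
  finally have "ennreal (1 / a powr s) * ennreal (Gamma s) = ennreal (1 / a powr s) * ennreal (a powr s) * ?I"
    by (simp add: mult.assoc)
  also have "ennreal (1 / a powr s) * ennreal (a powr s) = 1"
    using assms(2) by (simp add: ennreal_mult[symmetric])
  finally show ?thesis
    using assms by (simp add: ennreal_mult[symmetric] Gamma_real_pos less_imp_le)
qed

text \<open>As \<open>0 powr a = 0\<close> for every \<open>a\<close>, excluding 0 from the indicator does not change the function.\<close>

definition gamma_pdf :: "real \<Rightarrow> real \<Rightarrow> real" where
  "gamma_pdf s x = indicator {0<..} x * x powr (s - 1) * exp (- x) / Gamma s"

lemma borel_measurable_gamma_pdf [measurable]: "gamma_pdf s \<in> borel_measurable borel"
  unfolding gamma_pdf_def by measurable

lemma gamma_pdf_nonneg: "0 < s \<Longrightarrow> 0 \<le> gamma_pdf s x"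
  by (simp add: gamma_pdf_def Gamma_real_pos less_imp_le)

lemma gamma_law_eq_density: "s \<noteq> 0 \<Longrightarrow> gamma_law s = density lborel (\<lambda>x. ennreal (gamma_pdf s x))"
  unfolding gamma_law_def gamma_pdf_def
  by (auto intro!: arg_cong[where f="density lborel"] simp: fun_eq_iff indicator_def)

lemma sets_gamma_law [measurable_cong, simp]: "sets (gamma_law s) = sets borel"
  by (simp add: gamma_law_def)

lemma prob_space_gamma_law:
  assumes "0 \<le> s"
  shows "prob_space (gamma_law s)"
proof (cases "s = 0")
  case True
  then show ?thesis by (simp add: gamma_law_def prob_space_return)
next
  case False
  have "(\<integral>\<^sup>+x. ennreal (gamma_pdf s x) \<partial>lborel) =
      (\<integral>\<^sup>+x. ennreal (1 / Gamma s) * ennreal (indicator {0<..} x * x powr (s - 1) * exp (- 1 * x)) \<partial>lborel)"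
    using False assms by (intro nn_integral_cong) (simp add: gamma_pdf_def ennreal_mult[symmetric] Gamma_real_pos less_imp_le)
  also have "\<dots> = ennreal (1 / Gamma s) * ennreal (Gamma s / 1 powr s)"
    using False assms by (subst nn_integral_cmult, simp, subst nn_integral_gamma_scaled) auto
  also have "\<dots> = 1"
    using Gamma_real_pos[of s] False assms by (simp add: ennreal_mult[symmetric] less_imp_neq[symmetric])
  finally show ?thesis
    using False by (intro prob_spaceI) (simp add: gamma_law_eq_density emeasure_density)
qed

lemma AE_gamma_law_pos: "0 < s \<Longrightarrow> AE x in gamma_law s. 0 < x"
  by (subst gamma_law_eq_density) (auto simp: AE_density gamma_pdf_def indicator_def)

text \<open>Covers the point mass at 0, which is the law of the second Gamma variable when
  \<open>r = 1\<close>.\<close>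

lemma AE_gamma_law_nonneg:
  assumes "0 \<le> s"
  shows "AE x in gamma_law s. 0 \<le> x"
proof (cases "s = 0")
  case True
  then have "gamma_law s = return borel 0" by (simp add: gamma_law_def)
  moreover have "AE x in return borel (0::real). 0 \<le> x"
    by (subst AE_return) auto
  ultimately show ?thesis by metis
next
  case False
  with assms have "AE x in gamma_law s. 0 < x" by (intro AE_gamma_law_pos) simp
  then show ?thesis by eventually_elim simp
qed

section \<open>The ratio of Gamma variables\<close>

text \<open>With \<open>y = x * t\<close> the ratio becomes \<open>\<mu> * (1 + t)\<close>, free of
  \<open>x\<close>. The \<open>x\<close>-integral gives \<open>1 / (1 + t)\<close>, cancelling that
  factor, and the \<open>t\<close>-integral is a Gamma integral of shape \<open>1 - r\<close> and
  rate \<open>\<mu> * u\<close>. The result is the Gamma density of shape \<open>r\<close> and rate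
  \<mu> at \<open>u\<close>.\<close>

lemma nn_integral_gamma_ratio:
  fixes r \<mu> u :: real
  assumes r: "0 < r" "r \<le> 1" and "0 < \<mu>" "0 < u"
  shows "(\<integral>\<^sup>+(x, y). ennreal (\<mu> * (x + y) / x * exp (- u * (\<mu> * (x + y) / x))) \<partial>(gamma_law r \<Otimes>\<^sub>M gamma_law (1 - r)))
    = ennreal (\<mu> powr r * u powr (r - 1) * exp (- \<mu> * u) / Gamma r)"
proof -
  define F where "F x y = \<mu> * (x + y) / x * exp (- u * (\<mu> * (x + y) / x))" for x y :: real
  have F_meas [measurable]: "(\<lambda>(x, y). F x y) \<in> borel_measurable (borel \<Otimes>\<^sub>M borel)"
    unfolding F_def by measurable
  interpret G1: prob_space "gamma_law r" using r by (intro prob_space_gamma_law) simp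
  interpret G2: prob_space "gamma_law (1 - r)" using r by (intro prob_space_gamma_law) simp
  have "(\<integral>\<^sup>+(x, y). ennreal (F x y) \<partial>(gamma_law r \<Otimes>\<^sub>M gamma_law (1 - r))) =
      (\<integral>\<^sup>+x. \<integral>\<^sup>+y. ennreal (F x y) \<partial>gamma_law (1 - r) \<partial>gamma_law r)"
    by (subst G2.nn_integral_fst[symmetric]) auto
  also have "\<dots> = ennreal (\<mu> powr r * u powr (r - 1) * exp (- \<mu> * u) / Gamma r)"
  proof (cases "r = 1")
    case True
    \<comment> \<open>The second variable is 0 here, so the ratio is the constant \<mu>.\<close>
    have "(\<integral>\<^sup>+x. \<integral>\<^sup>+y. ennreal (F x y) \<partial>gamma_law (1 - r) \<partial>gamma_law r) = (\<integral>\<^sup>+x. ennreal (F x 0) \<partial>gamma_law r)"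
      using True by (simp add: gamma_law_def[of 0] nn_integral_return)
    also have "\<dots> = (\<integral>\<^sup>+x. ennreal (\<mu> * exp (- u * \<mu>)) \<partial>gamma_law r)"
    proof (rule nn_integral_cong_AE)
      show "AE x in gamma_law r. ennreal (F x 0) = ennreal (\<mu> * exp (- u * \<mu>))"
        using AE_gamma_law_pos[OF r(1)] by eventually_elim (auto simp: F_def)
    qed
    also have "\<dots> = ennreal (\<mu> * exp (- u * \<mu>))"
      using G1.emeasure_space_1 by simp
    finally show ?thesis
      using True assms by (simp add: mult_ac)
  next
    case False
    with r have r1: "0 < r" "0 < 1 - r" by auto
    \<comment> \<open>\<open>K\<close> gathers the factors depending on \<open>t\<close> alone;
      \<open>H\<close> below is what remains of the joint integrand after the substitution.\<close>
    define K where "K t = indicator {0<..} t * t powr (1 - r - 1) * exp (- (\<mu> * u) * t) *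
        (\<mu> * (1 + t) * exp (- \<mu> * u) / (Gamma r * Gamma (1 - r)))" for t
    have G: "0 < Gamma r" "0 < Gamma (1 - r)"
      using r1 by (auto intro: Gamma_real_pos)
    have K_nonneg: "0 \<le> K t" for t
      using G assms by (auto simp: K_def indicator_def)
    have [measurable]: "K \<in> borel_measurable borel"
      unfolding K_def by measurable
    \<comment> \<open>The factor \<open>x powr (1 - 1)\<close> gives the shape-1 form of the scaled
      Gamma integral.\<close>
    define H where "H x t = indicator {0<..} x * x powr (1 - 1) * exp (- (1 + t) * x)" for x t :: real
    have [measurable]: "(\<lambda>(x, y). H x y) \<in> borel_measurable (borel \<Otimes>\<^sub>M borel)"
      unfolding H_def by measurable
    have H_nonneg: "0 \<le> H x t" for x t by (simp add: H_def)
    have subst: "ennreal (gamma_pdf r x) * (\<integral>\<^sup>+y. ennreal (F x y) \<partial>gamma_law (1 - r)) =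
        (\<integral>\<^sup>+t. ennreal (K t * H x t) \<partial>lborel)" for x
    proof (cases "0 < x")
      case True
      have "(\<integral>\<^sup>+y. ennreal (F x y) \<partial>gamma_law (1 - r)) =
          (\<integral>\<^sup>+y. ennreal (gamma_pdf (1 - r) y) * ennreal (F x y) \<partial>lborel)"
        using False by (subst gamma_law_eq_density) (auto intro!: nn_integral_density)
      also have "\<dots> = ennreal \<bar>x\<bar> * (\<integral>\<^sup>+t. ennreal (gamma_pdf (1 - r) (0 + x * t)) * ennreal (F x (0 + x * t)) \<partial>lborel)"
        using True by (intro nn_integral_real_affine) auto
      finally have "ennreal (gamma_pdf r x) * (\<integral>\<^sup>+y. ennreal (F x y) \<partial>gamma_law (1 - r)) =
          (\<integral>\<^sup>+t. ennreal (gamma_pdf r x) * (ennreal \<bar>x\<bar> * (ennreal (gamma_pdf (1 - r) (0 + x * t)) * ennreal (F x (0 + x * t)))) \<partial>lborel)"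
        by (simp add: nn_integral_cmult)
      also have "\<dots> = (\<integral>\<^sup>+t. ennreal (K t * H x t) \<partial>lborel)"
      proof (rule nn_integral_cong)
        fix t :: real
        show "ennreal (gamma_pdf r x) * (ennreal \<bar>x\<bar> * (ennreal (gamma_pdf (1 - r) (0 + x * t)) * ennreal (F x (0 + x * t)))) =
          ennreal (K t * H x t)"
        proof (cases "0 < t")
          case t: True
          have "(x + x * t) / x = 1 + t" using True by (simp add: field_simps)
          then have F_eq: "F x (x * t) = \<mu> * (1 + t) * exp (- (u * (\<mu> * (1 + t))))"
            by (simp add: F_def times_divide_eq_right[symmetric] del: times_divide_eq_right)
          then have F_nonneg: "0 \<le> F x (x * t)" using t assms by simp
          \<comment> \<open>The Jacobian \<open>x\<close> cancels the powers of \<open>x\<close>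
            from the two densities.\<close>
          have p: "x * (x powr (r - 1) * x powr (1 - r - 1)) = 1"
            using True by (simp add: powr_diff powr_minus)
          have "gamma_pdf r x * (x * (gamma_pdf (1 - r) (x * t) * F x (x * t))) =
              x * (x powr (r - 1) * x powr (1 - r - 1)) * (t powr (1 - r - 1) * (exp (- x) * exp (- (x * t))) *
              F x (x * t) / (Gamma r * Gamma (1 - r)))"
            using True t by (simp add: gamma_pdf_def powr_mult field_simps)
          also have "\<dots> = t powr (1 - r - 1) * (exp (- x) * exp (- (x * t))) *
              F x (x * t) / (Gamma r * Gamma (1 - r))"
            unfolding p by simp
          also have "\<dots> = K t * H x t"
            unfolding F_eq K_def H_def using True t G by (simp add: divide_simps) (simp add: algebra_simps exp_add[symmetric])
          finally show ?thesis
            using True F_nonneg r1 by (simp add: ennreal_mult[symmetric] gamma_pdf_nonneg)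
        next
          case t: False
          then show ?thesis
            using True by (simp add: gamma_pdf_def K_def zero_less_mult_iff)
        qed
      qed
      finally show ?thesis .
    qed (simp add: gamma_pdf_def H_def)
    have "(\<integral>\<^sup>+x. \<integral>\<^sup>+y. ennreal (F x y) \<partial>gamma_law (1 - r) \<partial>gamma_law r) =
        (\<integral>\<^sup>+x. ennreal (gamma_pdf r x) * (\<integral>\<^sup>+y. ennreal (F x y) \<partial>gamma_law (1 - r)) \<partial>lborel)"
      using r(1) by (subst gamma_law_eq_density[of r]) (auto intro!: nn_integral_density)
    also have "\<dots> = (\<integral>\<^sup>+x. \<integral>\<^sup>+t. ennreal (K t * H x t) \<partial>lborel \<partial>lborel)"
      by (simp only: subst)
    also have "\<dots> = (\<integral>\<^sup>+t. \<integral>\<^sup>+x. ennreal (K t * H x t) \<partial>lborel \<partial>lborel)"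
      by (rule lborel_pair.Fubini'[symmetric]) measurable
    also have "\<dots> = (\<integral>\<^sup>+t. ennreal (\<mu> * exp (- \<mu> * u) / (Gamma r * Gamma (1 - r))) *
        ennreal (indicator {0<..} t * t powr (1 - r - 1) * exp (- (\<mu> * u) * t)) \<partial>lborel)"
    proof (rule nn_integral_cong)
      fix t :: real
      have "(\<integral>\<^sup>+x. ennreal (K t * H x t) \<partial>lborel) = ennreal (K t) * (\<integral>\<^sup>+x. ennreal (H x t) \<partial>lborel)"
        by (simp add: ennreal_mult K_nonneg H_nonneg nn_integral_cmult)
      also have "\<dots> = ennreal (\<mu> * exp (- \<mu> * u) / (Gamma r * Gamma (1 - r))) *
        ennreal (indicator {0<..} t * t powr (1 - r - 1) * exp (- (\<mu> * u) * t))"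
      proof (cases "0 < t")
        case True
        \<comment> \<open>The value \<open>1 / (1 + t)\<close> removes the factor
          \<open>1 + t\<close> inside \<open>K\<close>.\<close>
        then have "(\<integral>\<^sup>+x. ennreal (H x t) \<partial>lborel) = ennreal (1 / (1 + t))"
          unfolding H_def by (subst nn_integral_gamma_scaled) auto
        then show ?thesis
          using True G assms by (simp add: K_nonneg ennreal_mult[symmetric]) (simp add: K_def)
      qed (simp add: K_def)
      finally show "(\<integral>\<^sup>+x. ennreal (K t * H x t) \<partial>lborel) = ennreal (\<mu> * exp (- \<mu> * u) / (Gamma r * Gamma (1 - r))) *
        ennreal (indicator {0<..} t * t powr (1 - r - 1) * exp (- (\<mu> * u) * t))" .
    qed
    also have "\<dots> = ennreal (\<mu> * exp (- \<mu> * u) / (Gamma r * Gamma (1 - r))) * ennreal (Gamma (1 - r) / (\<mu> * u) powr (1 - r))"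
      using r1 assms by (subst nn_integral_cmult, simp, subst nn_integral_gamma_scaled) auto
    also have "\<dots> = ennreal (\<mu> * exp (- \<mu> * u) / (Gamma r * Gamma (1 - r)) * (Gamma (1 - r) / (\<mu> * u) powr (1 - r)))"
      using G assms by (intro ennreal_mult[symmetric]) auto
    also have "\<mu> * exp (- \<mu> * u) / (Gamma r * Gamma (1 - r)) * (Gamma (1 - r) / (\<mu> * u) powr (1 - r)) =
        \<mu> powr r * u powr (r - 1) * exp (- \<mu> * u) / Gamma r"
    proof -
      have *: "\<mu> / (\<mu> * u) powr (1 - r) = \<mu> powr r * u powr (r - 1)"
        using assms by (simp add: powr_mult powr_diff field_simps)
      have "\<mu> * exp (- \<mu> * u) / (Gamma r * Gamma (1 - r)) * (Gamma (1 - r) / (\<mu> * u) powr (1 - r)) =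
          \<mu> / (\<mu> * u) powr (1 - r) * exp (- \<mu> * u) / Gamma r"
        using G by simp
      then show ?thesis by (simp only: *)
    qed
    finally show ?thesis .
  qed
  finally show ?thesis by (simp add: F_def)
qed

lemma AE_gamma_ratio_pos:
  assumes "0 < r" "r \<le> 1" "0 < \<mu>"
  shows "AE g in gamma_law r \<Otimes>\<^sub>M gamma_law (1 - r). 0 < (case g of (x, y) \<Rightarrow> \<mu> * (x + y) / x)"
proof -
  interpret G1: prob_space "gamma_law r" using assms by (intro prob_space_gamma_law) simp
  interpret G2: prob_space "gamma_law (1 - r)" using assms by (intro prob_space_gamma_law) simp
  interpret G: pair_prob_space "gamma_law r" "gamma_law (1 - r)" ..
  show ?thesis
  proof (rule G.AE_pair_measure)
    show "AE x in gamma_law r. AE y in gamma_law (1 - r). 0 < (case (x, y) of (x, y) \<Rightarrow> \<mu> * (x + y) / x)"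
      using AE_gamma_law_pos[OF assms(1)]
    proof eventually_elim
      case x: (elim x)
      have "AE y in gamma_law (1 - r). 0 \<le> y"
        using assms by (intro AE_gamma_law_nonneg) simp
      then show ?case
        by eventually_elim (use x assms in simp)
    qed
  qed measurable
qed

subsection \<open>The mixing distribution\<close>

text \<open>A random rate: conditionally on it, the Poisson parameter of the mixture is exponential
  with this rate.\<close>

definition mixing_scale :: "real \<Rightarrow> real \<Rightarrow> real \<times> real \<times> real \<Rightarrow> real" where
  "mixing_scale \<alpha> \<mu> = (\<lambda>(s, x, y). s * (\<mu> * (x + y) / x) powr (1 / \<alpha>))"

lemma borel_measurable_mixing_scale [measurable]:
  "mixing_scale \<alpha> \<mu> \<in> borel_measurable (borel \<Otimes>\<^sub>M (borel \<Otimes>\<^sub>M borel))"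
  unfolding mixing_scale_def by measurable

lemma Y_fun_eq: "Y_fun \<alpha> \<mu> \<omega> = mixing_scale \<alpha> \<mu> \<omega> / (1 + mixing_scale \<alpha> \<mu> \<omega>)"
  by (simp add: Y_fun_def mixing_scale_def Let_def split: prod.split)

lemma borel_measurable_Y_fun [measurable]:
  "Y_fun \<alpha> \<mu> \<in> borel_measurable (borel \<Otimes>\<^sub>M (borel \<Otimes>\<^sub>M borel))"
  unfolding Y_fun_eq[abs_def] by measurable

lemma AE_mixing_scale_pos:
  assumes "0 < r" "r \<le> 1" "0 < \<mu>" "real_distribution P" "AE s in P. 0 < s"
  shows "AE \<omega> in P \<Otimes>\<^sub>M (gamma_law r \<Otimes>\<^sub>M gamma_law (1 - r)). 0 < mixing_scale \<alpha> \<mu> \<omega>"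
proof -
  interpret P: real_distribution P by fact
  interpret G1: prob_space "gamma_law r" using assms by (intro prob_space_gamma_law) simp
  interpret G2: prob_space "gamma_law (1 - r)" using assms by (intro prob_space_gamma_law) simp
  interpret G: pair_prob_space "gamma_law r" "gamma_law (1 - r)" ..
  interpret PG: pair_prob_space P "gamma_law r \<Otimes>\<^sub>M gamma_law (1 - r)" ..
  show ?thesis
  proof (rule PG.AE_pair_measure)
    show "AE s in P. AE g in gamma_law r \<Otimes>\<^sub>M gamma_law (1 - r). 0 < mixing_scale \<alpha> \<mu> (s, g)"
      using assms(5)
    proof eventually_elim
      case s: (elim s)
      from AE_gamma_ratio_pos[OF assms(1-3)] show ?case
      proof eventually_elim
        case (elim g)
        then have "0 < (case g of (x, y) \<Rightarrow> \<mu> * (x + y) / x) powr (1 / \<alpha>)"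
          by (metis less_irrefl powr_gt_zero)
        with s show ?case by (simp add: mixing_scale_def split: prod.splits)
      qed
    qed
  qed measurable
qed

text \<open>Given the Gamma ratio \<open>Z\<close>, put \<open>c = Z powr (1 / \<alpha>)\<close>.
  The differentiated Laplace transform at \<open>c * z\<close> turns into
  \<open>C * Z * exp (- (z powr \<alpha>) * Z)\<close>, and the Gamma ratio integral at
  \<open>u = z powr \<alpha>\<close> finishes.\<close>

lemma nn_integral_mixing_scale:
  assumes "0 < r" "r \<le> 1" "0 < \<alpha>" "\<alpha> \<le> 1" "0 < \<mu>"
    and "real_distribution P" "\<And>t. char P t = stable_char \<alpha> t" and z: "0 < z"
  shows "(\<integral>\<^sup>+\<omega>. ennreal (mixing_scale \<alpha> \<mu> \<omega> * exp (- mixing_scale \<alpha> \<mu> \<omega> * z))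
      \<partial>(P \<Otimes>\<^sub>M (gamma_law r \<Otimes>\<^sub>M gamma_law (1 - r)))) = ennreal (gg_density r \<alpha> \<mu> z)"
proof -
  interpret P: real_distribution P by fact
  interpret G1: prob_space "gamma_law r" using assms by (intro prob_space_gamma_law) simp
  interpret G2: prob_space "gamma_law (1 - r)" using assms by (intro prob_space_gamma_law) simp
  interpret G: pair_prob_space "gamma_law r" "gamma_law (1 - r)" ..
  interpret PG: pair_prob_space P "gamma_law r \<Otimes>\<^sub>M gamma_law (1 - r)" ..
  let ?G = "gamma_law r \<Otimes>\<^sub>M gamma_law (1 - r)"
  let ?Z = "\<lambda>(x, y). \<mu> * (x + y) / x"
  have [measurable]: "?Z \<in> borel_measurable (borel \<Otimes>\<^sub>M borel)" by measurable
  define C where "C = \<alpha> * z powr (\<alpha> - 1)"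
  have C: "0 \<le> C" using assms by (simp add: C_def)
  from AE_gamma_ratio_pos[OF assms(1,2,5)]
  have inner: "AE g in ?G. (\<integral>\<^sup>+s. ennreal (mixing_scale \<alpha> \<mu> (s, g) * exp (- mixing_scale \<alpha> \<mu> (s, g) * z)) \<partial>P) =
      ennreal C * ennreal (?Z g * exp (- (z powr \<alpha>) * ?Z g))"
  proof eventually_elim
    case (elim g)
    define Z where "Z = ?Z g"
    define c where "c = Z powr (1 / \<alpha>)"
    have Z: "0 < Z" using elim by (simp add: Z_def)
    then have c: "0 < c" by (simp add: c_def)
    have cZ: "c powr \<alpha> = Z" using Z assms by (simp add: c_def powr_powr)
    have W: "mixing_scale \<alpha> \<mu> (s, g) = s * c" for s
      by (simp add: mixing_scale_def c_def Z_def split: prod.split)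
    have "(\<integral>\<^sup>+s. ennreal (mixing_scale \<alpha> \<mu> (s, g) * exp (- mixing_scale \<alpha> \<mu> (s, g) * z)) \<partial>P) =
        (\<integral>\<^sup>+s. ennreal c * ennreal (s * exp (- (c * z) * s)) \<partial>P)"
      using c by (intro nn_integral_cong) (simp add: W ennreal_mult'[symmetric] mult_ac)
    also have "\<dots> = ennreal c * ennreal (\<alpha> * (c * z) powr (\<alpha> - 1) * exp (- ((c * z) powr \<alpha>)))"
      using c z nn_integral_stable_mult_exp[OF assms(3,4,6,7), of "c * z"] by (simp add: nn_integral_cmult)
    also have "\<dots> = ennreal (c * (\<alpha> * (c * z) powr (\<alpha> - 1) * exp (- ((c * z) powr \<alpha>))))"
      using c by (simp add: ennreal_mult')
    \<comment> \<open>Since \<open>c powr \<alpha> = Z\<close>, the powers of \<open>c\<close>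
      combine to a single factor \<open>Z\<close>, leaving \<open>C\<close> independent of the Gamma
      variables.\<close>
    also have "c * (\<alpha> * (c * z) powr (\<alpha> - 1) * exp (- ((c * z) powr \<alpha>))) = C * (Z * exp (- (z powr \<alpha>) * Z))"
      using c z cZ by (simp add: C_def powr_mult powr_diff mult_ac)
    finally show ?case using C by (simp add: ennreal_mult' Z_def)
  qed
  have "(\<integral>\<^sup>+\<omega>. ennreal (mixing_scale \<alpha> \<mu> \<omega> * exp (- mixing_scale \<alpha> \<mu> \<omega> * z)) \<partial>(P \<Otimes>\<^sub>M ?G)) =
      (\<integral>\<^sup>+g. \<integral>\<^sup>+s. ennreal (mixing_scale \<alpha> \<mu> (s, g) * exp (- mixing_scale \<alpha> \<mu> (s, g) * z)) \<partial>P \<partial>?G)"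
    by (subst PG.nn_integral_snd[symmetric]) auto
  also have "\<dots> = (\<integral>\<^sup>+g. ennreal C * ennreal (?Z g * exp (- (z powr \<alpha>) * ?Z g)) \<partial>?G)"
    using inner by (rule nn_integral_cong_AE)
  also have "\<dots> = ennreal C * (\<integral>\<^sup>+g. ennreal (?Z g * exp (- (z powr \<alpha>) * ?Z g)) \<partial>?G)"
    by (rule nn_integral_cmult) measurable
  also have "(\<integral>\<^sup>+g. ennreal (?Z g * exp (- (z powr \<alpha>) * ?Z g)) \<partial>?G) =
      ennreal (\<mu> powr r * (z powr \<alpha>) powr (r - 1) * exp (- \<mu> * z powr \<alpha>) / Gamma r)"
    using nn_integral_gamma_ratio[OF assms(1,2,5), of "z powr \<alpha>"] z by (simp add: case_prod_unfold)
  also have "ennreal C * ennreal (\<mu> powr r * (z powr \<alpha>) powr (r - 1) * exp (- \<mu> * z powr \<alpha>) / Gamma r) =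
      ennreal (C * (\<mu> powr r * (z powr \<alpha>) powr (r - 1) * exp (- \<mu> * z powr \<alpha>) / Gamma r))"
    using C by (rule ennreal_mult'[symmetric])
  also have "C * (\<mu> powr r * (z powr \<alpha>) powr (r - 1) * exp (- \<mu> * z powr \<alpha>) / Gamma r) = gg_density r \<alpha> \<mu> z"
  proof -
    \<comment> \<open>The exponents add up: (\<alpha> - 1) + \<alpha> (r - 1) = \<alpha> r -
      1.\<close>
    have "z powr (\<alpha> - 1) * (z powr \<alpha>) powr (r - 1) = z powr (\<alpha> * r - 1)"
      by (simp add: powr_powr powr_add[symmetric] algebra_simps)
    then show ?thesis using assms by (simp add: C_def gg_density_def mult_ac)
  qed
  finally show ?thesis .
qed

section \<open>Geometric laws as Poisson mixtures\<close>

lemma gg_density_nonneg: "0 < r \<Longrightarrow> 0 \<le> gg_density r \<alpha> \<mu> z"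
  by (simp add: gg_density_def Gamma_real_pos less_imp_le)

lemma borel_measurable_gg_density [measurable]: "gg_density r \<alpha> \<mu> \<in> borel_measurable borel"
  unfolding gg_density_def by measurable

text \<open>A Poisson law whose parameter is exponential with rate \<open>w\<close> is geometric
  with success probability \<open>w / (1 + w)\<close>: the exponentials merge to rate
  \<open>1 + w\<close>, leaving a Gamma integral of shape \<open>k + 1\<close>.\<close>

lemma mixed_geometric_as_mixed_poisson:
  fixes w :: real
  assumes "0 < w"
  shows "ennreal (w / (1 + w) * (1 - w / (1 + w)) ^ k) =
    (\<integral>\<^sup>+z. ennreal (indicator {0<..} z * z ^ k * exp (- z) / fact k) * ennreal (w * exp (- w * z)) \<partial>lborel)"
proof -
  have "(\<integral>\<^sup>+z. ennreal (indicator {0<..} z * z ^ k * exp (- z) / fact k) * ennreal (w * exp (- w * z)) \<partial>lborel) =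
      (\<integral>\<^sup>+z. ennreal (w / fact k) * ennreal (indicator {0<..} z * z powr (real (Suc k) - 1) * exp (- (1 + w) * z)) \<partial>lborel)"
  proof (rule nn_integral_cong)
    fix z :: real
    show "ennreal (indicator {0<..} z * z ^ k * exp (- z) / fact k) * ennreal (w * exp (- w * z)) =
      ennreal (w / fact k) * ennreal (indicator {0<..} z * z powr (real (Suc k) - 1) * exp (- (1 + w) * z))"
      using assms by (cases "0 < z")
        (simp_all add: ennreal_mult[symmetric] powr_realpow algebra_simps exp_add[symmetric])
  qed
  also have "\<dots> = ennreal (w / fact k) * ennreal (Gamma (real (Suc k)) / (1 + w) powr real (Suc k))"
    using assms by (subst nn_integral_cmult, simp, subst nn_integral_gamma_scaled) auto
  also have "\<dots> = ennreal (w / fact k * (fact k / (1 + w) ^ Suc k))"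
    using assms Gamma_fact[of k, where 'a=real] powr_realpow[of "1 + w" "Suc k"]
    by (subst ennreal_mult[symmetric]) (auto simp: add.commute simp del: power_Suc)
  also have "w / fact k * (fact k / (1 + w) ^ Suc k) = w / (1 + w) * (1 - w / (1 + w)) ^ k"
  proof -
    have "1 - w / (1 + w) = 1 / (1 + w)" using assms by (simp add: field_simps)
    then show ?thesis by (simp only:) (simp add: power_one_over)
  qed
  finally show ?thesis ..
qed

theorem theorem2:
  fixes r \<alpha> \<mu> :: real and PS :: "real measure"
  assumes "0 < r" "r \<le> 1" "0 < \<alpha>" "\<alpha> \<le> 1" "0 < \<mu>"
    and "real_distribution PS"
    and "\<And>t. char PS t = stable_char \<alpha> t"
  shows "(AE y in Y_law PS r \<alpha> \<mu>. 0 < y \<and> y < 1) \<and>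
         (\<forall>k::nat. gnb_prob r \<alpha> \<mu> k = (\<integral>y. y * (1 - y) ^ k \<partial>Y_law PS r \<alpha> \<mu>))"
proof -
  interpret P: real_distribution PS by fact
  interpret G1: prob_space "gamma_law r" using assms by (intro prob_space_gamma_law) simp
  interpret G2: prob_space "gamma_law (1 - r)" using assms by (intro prob_space_gamma_law) simp
  interpret G: pair_prob_space "gamma_law r" "gamma_law (1 - r)" ..
  interpret PG: pair_prob_space PS "gamma_law r \<Otimes>\<^sub>M gamma_law (1 - r)" ..
  define M where "M = PS \<Otimes>\<^sub>M (gamma_law r \<Otimes>\<^sub>M gamma_law (1 - r))"
  have sets_M [measurable_cong]: "sets M = sets (borel \<Otimes>\<^sub>M (borel \<Otimes>\<^sub>M borel))"
    unfolding M_def by (intro sets_pair_measure_cong) auto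
  interpret M: prob_space M unfolding M_def by unfold_locales
  interpret LM: pair_sigma_finite lborel M ..
  let ?W = "mixing_scale \<alpha> \<mu>"
  have W_pos: "AE \<omega> in M. 0 < ?W \<omega>"
    unfolding M_def using assms AE_stable_pos[OF assms(3,4,6,7)] by (intro AE_mixing_scale_pos)
  have law: "Y_law PS r \<alpha> \<mu> = distr M borel (Y_fun \<alpha> \<mu>)"
    by (simp add: Y_law_def M_def)
  have Y01: "AE y in Y_law PS r \<alpha> \<mu>. 0 < y \<and> y < 1"
  proof -
    have "AE \<omega> in M. 0 < Y_fun \<alpha> \<mu> \<omega> \<and> Y_fun \<alpha> \<mu> \<omega> < 1"
      using W_pos by eventually_elim (simp add: Y_fun_eq)
    then show ?thesis
      unfolding law by (subst AE_distr_iff) auto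
  qed
  have "gnb_prob r \<alpha> \<mu> k = (\<integral>y. y * (1 - y) ^ k \<partial>Y_law PS r \<alpha> \<mu>)" for k
  proof -
    let ?p = "\<lambda>z::real. indicator {0<..} z * z ^ k * exp (- z) / fact k"
    \<comment> \<open>The integrand is almost surely nonnegative, so the computation moves to
      extended nonnegative integrals, where Tonelli applies directly.\<close>
    have "(\<integral>y. y * (1 - y) ^ k \<partial>Y_law PS r \<alpha> \<mu>) = enn2real (\<integral>\<^sup>+y. ennreal (y * (1 - y) ^ k) \<partial>Y_law PS r \<alpha> \<mu>)"
    proof (rule integral_eq_nn_integral)
      show "AE y in Y_law PS r \<alpha> \<mu>. 0 \<le> y * (1 - y) ^ k"
        using Y01 by eventually_elim simp
    qed (simp add: law)
    also have "(\<integral>\<^sup>+y. ennreal (y * (1 - y) ^ k) \<partial>Y_law PS r \<alpha> \<mu>) =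
        (\<integral>\<^sup>+\<omega>. ennreal (Y_fun \<alpha> \<mu> \<omega> * (1 - Y_fun \<alpha> \<mu> \<omega>) ^ k) \<partial>M)"
      unfolding law by (rule nn_integral_distr) auto
    also have "\<dots> = (\<integral>\<^sup>+\<omega>. \<integral>\<^sup>+z. ennreal (?p z) * ennreal (?W \<omega> * exp (- ?W \<omega> * z)) \<partial>lborel \<partial>M)"
    proof (rule nn_integral_cong_AE)
      show "AE \<omega> in M. ennreal (Y_fun \<alpha> \<mu> \<omega> * (1 - Y_fun \<alpha> \<mu> \<omega>) ^ k) =
          (\<integral>\<^sup>+z. ennreal (?p z) * ennreal (?W \<omega> * exp (- ?W \<omega> * z)) \<partial>lborel)"
        using W_pos by eventually_elim (simp only: Y_fun_eq mixed_geometric_as_mixed_poisson)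
    qed
    \<comment> \<open>After the exchange the inner integral averages the exponential densities over
      the random rate, producing the generalized gamma density.\<close>
    also have "\<dots> = (\<integral>\<^sup>+z. \<integral>\<^sup>+\<omega>. ennreal (?p z) * ennreal (?W \<omega> * exp (- ?W \<omega> * z)) \<partial>M \<partial>lborel)"
      by (rule LM.Fubini') measurable
    also have "\<dots> = (\<integral>\<^sup>+z. ennreal (1 / fact k * (indicator {0..} z * exp (- z) * z ^ k * gg_density r \<alpha> \<mu> z)) \<partial>lborel)"
    proof (rule nn_integral_cong)
      fix z :: real
      show "(\<integral>\<^sup>+\<omega>. ennreal (?p z) * ennreal (?W \<omega> * exp (- ?W \<omega> * z)) \<partial>M) =
          ennreal (1 / fact k * (indicator {0..} z * exp (- z) * z ^ k * gg_density r \<alpha> \<mu> z))"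
      proof (cases "0 < z")
        case True
        have "(\<integral>\<^sup>+\<omega>. ennreal (?p z) * ennreal (?W \<omega> * exp (- ?W \<omega> * z)) \<partial>M) = ennreal (?p z) * ennreal (gg_density r \<alpha> \<mu> z)"
          using nn_integral_mixing_scale[OF assms True] unfolding M_def[symmetric]
          by (subst nn_integral_cmult) auto
        also have "\<dots> = ennreal (?p z * gg_density r \<alpha> \<mu> z)"
          using True by (intro ennreal_mult'[symmetric]) auto
        finally show ?thesis using True by (simp add: mult_ac)
      \<comment> \<open>For \<open>z \<le> 0\<close> both sides vanish; at \<open>z = 0\<close> the
        right side does so because \<open>0 powr _\<close> is 0.\<close>
      qed (auto simp: gg_density_def indicator_def)
    qed
    also have "enn2real \<dots> = (\<integral>z. 1 / fact k * (indicator {0..} z * exp (- z) * z ^ k * gg_density r \<alpha> \<mu> z) \<partial>lborel)"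
      using assms(1) by (intro integral_eq_nn_integral[symmetric] AE_I2)
        (auto simp: gg_density_nonneg indicator_def)
    also have "\<dots> = gnb_prob r \<alpha> \<mu> k"
      unfolding gnb_prob_def by (rule integral_mult_right_zero)
    finally show ?thesis ..
  qed
  with Y01 show ?thesis by blast
qed

end
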